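(* Let $(\lambda_{i})_{i\in\mathbb N}$ and $\boldsymbol d=(d_{i})_{i\in\mathbb N}$ be sequences of (strictly) positive real numbers converging to $0$ such that $\lambda_{i}\geq d_{i}$ for all $i\in\mathbb N$ and \[\lambda_{-1} := \sum_{i=1}^{\infty}(\lambda_{i}-d_{i})\in(0,\infty).\] If $E$ is a self-adjoint operator with diagonal $\boldsymbol \lambda:=(-\lambda_{-1},\lambda_{1},\lambda_{2},\ldots)$, then $\boldsymbol d$ is also a diagonal of $E$.
   Context: Operators are bounded linear operators on a separable Hilbert space $\mathcal H$. A real family $(c_i)_{i\in I}$ is a diagonal of a self-adjoint operator $E$ on $\mathcal H$ if there is an orthonormal basis $(e_i)_{i\in I}$ of $\mathcal H$ with $\langle Ee_i,e_i\rangle=c_i$ for all $i\in I$. *)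

theory Defs
  imports "HOL-Analysis.Analysis"
begin

text \<open>The scalar field of a Hilbert space is either the reals or the complex numbers; the class
  \<open>real_or_complex\<close> covers both at once. Up to isomorphism these are the only members: expanding
  \<open>norm (x + 1) ^ 2\<close> by the last axiom shows that \<open>x + conj x\<close> is real, so every scalar is a root
  of a real quadratic polynomial.\<close>

class real_or_complex = real_normed_field +
  fixes conj :: "'a \<Rightarrow> 'a"
  assumes conj_add: "conj (x + y) = conj x + conj y"
    and conj_mult: "conj (x * y) = conj x * conj y"
    and conj_mult_self: "conj x * x = (norm x)\<^sup>2 *\<^sub>R 1"

instantiation real :: real_or_complex
begin
definition conj_real :: "real \<Rightarrow> real" where "conj_real x = x"
instance
  by standard (simp_all add: conj_real_def power2_eq_square)
end

instantiation complex :: real_or_complex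
begin
definition conj_complex :: "complex \<Rightarrow> complex" where "conj_complex = cnj"
instance
proof
  fix x y :: complex
  show "conj (x + y) = conj x + conj y" "conj (x * y) = conj x * conj y"
    by (simp_all add: conj_complex_def)
  show "conj x * x = (norm x)\<^sup>2 *\<^sub>R 1"
    unfolding conj_complex_def scaleR_conv_of_real
    by (metis complex_norm_square mult.commute mult_1_right)
qed
end

text \<open>The norm, and hence topology and completeness, come from the type \<open>'a\<close>; the axiom
  \<open>ip_self\<close> says that this norm is the one induced by the inner product, which is linear in its
  first argument.\<close>

locale hilbert_space = vector_space smul
  for smul :: "'k::real_or_complex \<Rightarrow> 'a::{real_normed_vector, complete_space} \<Rightarrow> 'a" +
  fixes ip :: "'a \<Rightarrow> 'a \<Rightarrow> 'k"
  assumes smul_of_real: "smul (of_real r) x = r *\<^sub>R x"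
    and ip_add_left: "ip (x + y) z = ip x z + ip y z"
    and ip_smul_left: "ip (smul c x) y = c * ip x y"
    and ip_commute: "ip y x = conj (ip x y)"
    and ip_self: "ip x x = of_real ((norm x)\<^sup>2)"

lemma hilbert_space_real:
  "hilbert_space (scaleR :: real \<Rightarrow> 'a::{real_inner, complete_space} \<Rightarrow> 'a) inner"
  by unfold_locales
    (simp_all add: scaleR_right_distrib scaleR_left_distrib inner_add_left inner_add_right inner_commute
      conj_real_def power2_norm_eq_inner)

lemma hilbert_space_complex: "hilbert_space (*) (\<lambda>x y :: complex. x * cnj y)"
  by unfold_locales
    (simp_all add: algebra_simps conj_complex_def scaleR_conv_of_real complex_norm_square
      flip: of_real_power)

definition bounded_operator :: "('k::field \<Rightarrow> 'a::real_normed_vector \<Rightarrow> 'a) \<Rightarrow> ('a \<Rightarrow> 'a) \<Rightarrow> bool"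
  where "bounded_operator smul E \<longleftrightarrow>
    Vector_Spaces.linear smul smul E \<and> (\<exists>K. \<forall>x. norm (E x) \<le> K * norm x)"

definition self_adjoint ::
    "('k::field \<Rightarrow> 'a::real_normed_vector \<Rightarrow> 'a) \<Rightarrow> ('a \<Rightarrow> 'a \<Rightarrow> 'k) \<Rightarrow> ('a \<Rightarrow> 'a) \<Rightarrow> bool"
  where "self_adjoint smul ip E \<longleftrightarrow>
    bounded_operator smul E \<and> (\<forall>x y. ip (E x) y = ip x (E y))"

definition orthonormal_basis ::
    "('k::field \<Rightarrow> 'a::real_normed_vector \<Rightarrow> 'a) \<Rightarrow> ('a \<Rightarrow> 'a \<Rightarrow> 'k) \<Rightarrow> 'i set \<Rightarrow> ('i \<Rightarrow> 'a) \<Rightarrow> bool"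
  where "orthonormal_basis smul ip I e \<longleftrightarrow>
    (\<forall>i\<in>I. \<forall>j\<in>I. ip (e i) (e j) = (if i = j then 1 else 0)) \<and>
    closure (module.span smul (e ` I)) = UNIV"

definition is_diagonal ::
    "('k::real_or_complex \<Rightarrow> 'a::real_normed_vector \<Rightarrow> 'a) \<Rightarrow> ('a \<Rightarrow> 'a \<Rightarrow> 'k) \<Rightarrow>
      'i set \<Rightarrow> ('i \<Rightarrow> real) \<Rightarrow> ('a \<Rightarrow> 'a) \<Rightarrow> bool"
  where "is_diagonal smul ip I c E \<longleftrightarrow>
    (\<exists>e. orthonormal_basis smul ip I e \<and> (\<forall>i\<in>I. ip (E (e i)) (e i) = of_real (c i)))"

end

theory Submission
  imports Defs
begin

text \<open>
  Rotating an orthonormal pair \<open>w, h\<close> inside its plane moves the diagonal entry of \<open>w\<close> to any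
  prescribed value between the entries of \<open>w\<close> and \<open>h\<close>, with the sum of the two entries preserved.
  Starting from one basis vector and rotating it successively with all the others yields vectors
  \<open>e\<^sub>n\<close> and remainders \<open>w\<^sub>n\<close>. Carried out from the vector of the negative entry, this gives the
  \<open>e\<^sub>n\<close> the diagonal \<open>d\<close>, and they form a basis as soon as the cosines do not tend to \<open>1\<close>,
  for then \<open>w\<^sub>n\<close> tends weakly to \<open>0\<close>.

  The cosines may well tend to \<open>1\<close> if the excesses \<open>\<lambda>\<^sub>n - d\<^sub>n\<close> are tiny compared with \<open>\<lambda>\<^sub>n\<close>.
  Therefore part of one strictly positive excess is first spread, in geometric portions, over a sparse
  set of indices \<open>m\<^sub>k\<close> at which both \<open>\<lambda>\<close> and the tail of the excesses are at most the \<open>k\<close>-th portion.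
  This is again a chain of rotations, now with summable angles, so that its remainders converge in
  norm to one more basis vector.
\<close>

section \<open>Conjugation of scalars, inner products and closed spans\<close>

lemma conj_of_real: "conj (of_real r) = (of_real r :: 'k::real_or_complex)"
proof (cases "r = 0")
  case True
  \<comment> \<open>At 0 the axiom \<open>conj_mult_self\<close> carries no information, so
    additivity has to supply the value.\<close>
  have "conj (0 + 0) = conj 0 + (conj 0 :: 'k)" by (rule conj_add)
  then show ?thesis using True by simp
next
  case False
  have "conj (of_real r) * of_real r = of_real r * (of_real r :: 'k)"
    using conj_mult_self[of "of_real r :: 'k"]
    by (simp add: scaleR_conv_of_real power2_eq_square)
  then show ?thesis using False by simp
qed

text \<open>The norm axiom makes the square of \<open>z\<close> equal to the square of the real
  number \<open>norm z\<close>, which in a field leaves only plus or minus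
  \<open>norm z\<close>.\<close>

lemma conj_fixed_imp_real:
  fixes z :: "'k::real_or_complex"
  assumes "conj z = z"
  obtains r where "z = of_real r"
proof -
  have "z\<^sup>2 = (of_real (norm z))\<^sup>2"
    using conj_mult_self[of z] assms by (simp add: power2_eq_square scaleR_conv_of_real)
  then have "z = of_real (norm z) \<or> z = of_real (- norm z)"
    by (simp add: power2_eq_iff)
  then show thesis using that by blast
qed

context hilbert_space
begin

lemma ip_add_right: "ip x (y + z) = ip x y + ip x z"
  by (metis conj_add ip_add_left ip_commute)

lemma ip_scaleR_left: "ip (r *\<^sub>R x) y = of_real r * ip x y"
  by (metis ip_smul_left smul_of_real)

lemma ip_smul_right: "ip x (smul c y) = conj c * ip x y"
  by (metis conj_mult ip_smul_left ip_commute)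

lemma ip_scaleR_right: "ip x (r *\<^sub>R y) = of_real r * ip x y"
  by (metis ip_smul_right smul_of_real conj_of_real)

lemma ip_minus_left: "ip (- x) y = - ip x y"
  using ip_scaleR_left[of "-1" x y] by simp

lemma ip_minus_right: "ip x (- y) = - ip x y"
  using ip_scaleR_right[of x "-1" y] by simp

lemma ip_diff_left: "ip (x - y) z = ip x z - ip y z"
  using ip_add_left[of x "- y" z] by (simp add: ip_minus_left)

lemma ip_diff_right: "ip x (y - z) = ip x y - ip x z"
  using ip_add_right[of x y "- z"] by (simp add: ip_minus_right)

lemmas ip_linear = ip_add_left ip_add_right ip_diff_left ip_diff_right ip_scaleR_left ip_scaleR_right
  ip_minus_left ip_minus_right

lemma ip_zero_commute: "ip x y = 0 \<Longrightarrow> ip y x = 0"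
  using ip_commute[of y x] conj_of_real[of 0, where 'k='k] by simp

lemma norm_eq_1_if_ip_self:
  assumes "ip x x = 1"
  shows "norm x = 1"
proof -
  have "of_real ((norm x)\<^sup>2) = (of_real 1 :: 'k)"
    using assms unfolding ip_self by simp
  then have "(norm x)\<^sup>2 = 1" using of_real_eq_iff by blast
  then show ?thesis by (simp add: power2_eq_1_iff) (use norm_ge_zero[of x] in linarith)
qed

lemma norm_smul: "norm (smul c x) = norm c * norm x"
proof -
  have "(of_real ((norm (smul c x))\<^sup>2) :: 'k) = (c * conj c) * ip x x"
    unfolding ip_self[symmetric] by (simp add: ip_smul_left ip_smul_right)
  also have "\<dots> = of_real ((norm c * norm x)\<^sup>2)"
    using conj_mult_self[of c]
    by (simp add: ip_self mult.commute[of c] scaleR_conv_of_real power_mult_distrib)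
  finally have "(norm (smul c x))\<^sup>2 = (norm c * norm x)\<^sup>2"
    using of_real_eq_iff by blast
  then show ?thesis by simp
qed

lemma norm_ip_le: "norm (ip x y) \<le> norm x * norm y"
proof (cases "y = 0")
  case True
  then show ?thesis using ip_scaleR_right[of x 0 y] by simp
next
  case False
  \<comment> \<open>The component of \<open>x\<close> orthogonal to \<open>y\<close>, multiplied by
    the square of \<open>norm y\<close> to avoid division. Cauchy-Schwarz says that its squared norm
    is nonnegative.\<close>
  define z where "z = (norm y)\<^sup>2 *\<^sub>R x - smul (ip x y) y"
  have c: "ip x y * ip y x = of_real ((norm (ip x y))\<^sup>2)"
    using conj_mult_self[of "ip x y"]
    by (simp add: ip_commute[of y x] mult.commute scaleR_conv_of_real)
  have "ip z z = of_real ((norm y)\<^sup>2) * (of_real ((norm y)\<^sup>2) * ip x x - ip x y * ip y x)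
      - ip x y * (of_real ((norm y)\<^sup>2) * ip y x - ip y x * ip y y)"
    unfolding z_def
    by (simp add: ip_linear ip_smul_left ip_smul_right ip_commute[of y x, symmetric] algebra_simps)
  also have "\<dots> = of_real ((norm y)\<^sup>2 * ((norm y)\<^sup>2 * (norm x)\<^sup>2 - (norm (ip x y))\<^sup>2))"
    unfolding c by (simp add: ip_self algebra_simps)
  finally have "(norm z)\<^sup>2 = (norm y)\<^sup>2 * ((norm y)\<^sup>2 * (norm x)\<^sup>2 - (norm (ip x y))\<^sup>2)"
    unfolding ip_self using of_real_eq_iff by blast
  then have "0 \<le> (norm y)\<^sup>2 * ((norm y)\<^sup>2 * (norm x)\<^sup>2 - (norm (ip x y))\<^sup>2)"
    by (metis zero_le_power2)
  then have "(norm (ip x y))\<^sup>2 \<le> (norm x * norm y)\<^sup>2"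
    using False by (simp add: zero_le_mult_iff power_mult_distrib mult.commute)
  then show ?thesis by (rule power2_le_imp_le) simp
qed

lemma bounded_bilinear_ip: "bounded_bilinear ip"
  by standard
    (auto simp: ip_linear scaleR_conv_of_real intro!: exI[of _ 1] norm_ip_le)

lemma bounded_linear_smul: "bounded_linear (smul c)"
proof
  show "smul c (r *\<^sub>R x) = r *\<^sub>R smul c x" for r x
    by (metis mult.commute scale_scale smul_of_real)
  show "\<exists>K. \<forall>x. norm (smul c x) \<le> norm x * K"
    by (intro exI[of _ "norm c"]) (simp add: norm_smul mult.commute)
qed (simp add: scale_right_distrib)

lemma span_scaleR: "x \<in> span A \<Longrightarrow> r *\<^sub>R x \<in> span A"
  by (metis smul_of_real span_scale)

lemma subspace_closure:
  assumes "subspace S"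
  shows "subspace (closure S)"
proof (rule subspaceI)
  show "0 \<in> closure S"
    using assms closure_subset subspace_0 by blast
next
  fix x y assume "x \<in> closure S" "y \<in> closure S"
  then obtain f g where "\<And>n. f n \<in> S" "f \<longlonglongrightarrow> x" "\<And>n. g n \<in> S" "g \<longlonglongrightarrow> y"
    unfolding closure_sequential by blast
  then show "x + y \<in> closure S"
    unfolding closure_sequential
    by (intro exI[of _ "\<lambda>n. f n + g n"]) (auto intro: tendsto_add subspace_add[OF assms])
next
  fix c x assume "x \<in> closure S"
  then obtain f where "\<And>n. f n \<in> S" "f \<longlonglongrightarrow> x"
    unfolding closure_sequential by blast
  then show "smul c x \<in> closure S"
    unfolding closure_sequential
    by (intro exI[of _ "\<lambda>n. smul c (f n)"])
      (auto intro: bounded_linear.tendsto[OF bounded_linear_smul] subspace_scale[OF assms])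
qed

lemma closure_span_eq_UNIV:
  assumes "closure (span A) = UNIV" "A \<subseteq> closure (span B)"
  shows "closure (span B) = UNIV"
proof -
  have "span A \<subseteq> closure (span B)"
    using assms(2) by (intro span_minimal subspace_closure subspace_span)
  then have "closure (span A) \<subseteq> closure (span B)"
    by (rule closure_minimal) simp
  then show ?thesis using assms(1) by auto
qed

end

lemma in_closure_if_tendsto:
  fixes x :: "'b::real_normed_vector"
  assumes "\<And>n. x - y n \<in> S" "y \<longlonglongrightarrow> l"
  shows "x - l \<in> closure S"
  unfolding closure_sequential using assms by (intro exI[of _ "\<lambda>n. x - y n"]) (auto intro: tendsto_diff)

section \<open>Plane rotations with a prescribed diagonal entry\<close>

text \<open>The off-diagonal entry \<open>B\<close> is not under control, but the sign of \<open>s\<close> can be chosen such that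
  \<open>c * s * B \<le> 0\<close>. The resulting inequality bounds \<open>s\<close> from below if \<open>X < Y\<close> and from above if
  \<open>Y < X\<close>.\<close>

lemma rotation_parameters:
  fixes X Y B t :: real
  assumes "t \<in> closed_segment X Y"
  obtains c s where "0 \<le> c" "c\<^sup>2 + s\<^sup>2 = 1" "c\<^sup>2 * X + s\<^sup>2 * Y + c * s * B = t"
    "t - X \<le> (Y - X) * s\<^sup>2" "t = X \<Longrightarrow> s = 0"
proof (cases "t = X")
  case True
  \<comment> \<open>The intermediate value argument below could return a nonzero angle here; the
    last clause demands the identity.\<close>
  show thesis by (rule that[of 1 0]) (simp_all add: True)
next
  case False
  define \<sigma> :: real where "\<sigma> = (if B \<le> 0 then 1 else - 1)"
  have \<sigma>: "\<sigma>\<^sup>2 = 1" "\<sigma> * B \<le> 0" by (auto simp: \<sigma>_def)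
  define g where "g = (\<lambda>\<theta>. (cos \<theta>)\<^sup>2 * X + (sin \<theta>)\<^sup>2 * Y + cos \<theta> * (\<sigma> * sin \<theta>) * B)"
  have cont: "continuous_on {0..pi/2} g"
    unfolding g_def by (intro continuous_intros)
  \<comment> \<open>The quarter turn leads continuously from the entry \<open>X\<close> to the entry
    \<open>Y\<close>.\<close>
  have "t \<in> g ` {0..pi/2}"
  proof -
    have "connected (g ` {0..pi/2})" by (intro connected_continuous_image cont) simp
    moreover have "g 0 = X" "g (pi/2) = Y" by (simp_all add: g_def)
    then have "X \<in> g ` {0..pi/2}" "Y \<in> g ` {0..pi/2}"
      by (force intro: image_eqI[of _ _ 0], force intro: image_eqI[of _ _ "pi/2"])
    ultimately have "closed_segment X Y \<subseteq> g ` {0..pi/2}"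
      by (metis closed_segment_subset is_interval_connected_1 is_interval_convex_1)
    then show ?thesis using assms by blast
  qed
  then obtain \<theta> where \<theta>: "0 \<le> \<theta>" "\<theta> \<le> pi/2" "g \<theta> = t" by auto
  have nn: "0 \<le> cos \<theta>" "0 \<le> sin \<theta>"
    using \<theta> by (auto intro!: cos_ge_zero sin_ge_zero)
  then have B: "cos \<theta> * (\<sigma> * sin \<theta>) * B \<le> 0"
    using mult_nonneg_nonpos[OF mult_nonneg_nonneg[OF nn] \<sigma>(2)] by (simp add: mult_ac)
  show thesis
  proof (rule that[of "cos \<theta>" "\<sigma> * sin \<theta>"])
    show "(cos \<theta>)\<^sup>2 * X + (\<sigma> * sin \<theta>)\<^sup>2 * Y + cos \<theta> * (\<sigma> * sin \<theta>) * B = t"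
      using \<theta>(3) by (simp add: g_def power_mult_distrib \<sigma>)
    have "t - X = (Y - X) * (sin \<theta>)\<^sup>2 + cos \<theta> * (\<sigma> * sin \<theta>) * B"
      unfolding \<theta>(3)[symmetric] g_def cos_squared_eq by (simp add: algebra_simps)
    then show "t - X \<le> (Y - X) * (\<sigma> * sin \<theta>)\<^sup>2"
      using B by (simp add: power_mult_distrib \<sigma>)
  qed (use nn False in \<open>simp_all add: power_mult_distrib \<sigma>\<close>)
qed


context hilbert_space
begin

text \<open>The two summands are conjugate to each other. Their sum is the cross term of the
  quadratic form of \<open>E\<close>, so even over the complex numbers rotations with real
  coefficients lead to a real equation.\<close>

lemma self_adjoint_polar_real:
  assumes "self_adjoint smul ip E"
  obtains B where "ip (E x) y + ip (E y) x = of_real B"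
proof (rule conj_fixed_imp_real)
  show "conj (ip (E x) y + ip (E y) x) = ip (E x) y + ip (E y) x"
    using assms unfolding self_adjoint_def by (simp add: conj_add add.commute flip: ip_commute)
qed

lemma bounded_linear_self_adjoint:
  assumes "self_adjoint smul ip E"
  shows "bounded_linear E"
proof -
  have lin: "Vector_Spaces.linear smul smul E" and "\<exists>K. \<forall>x. norm (E x) \<le> K * norm x"
    using assms by (auto simp: self_adjoint_def bounded_operator_def)
  interpret E: Vector_Spaces.linear smul smul E by (fact lin)
  show ?thesis
  proof
    show "E (r *\<^sub>R x) = r *\<^sub>R E x" for r x
      by (metis E.scale smul_of_real)
    show "\<exists>K. \<forall>x. norm (E x) \<le> norm x * K"
      using \<open>\<exists>K. _ K\<close> by (simp add: mult.commute)
  qed (rule E.add)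
qed

lemma ip_rotation:
  assumes "self_adjoint smul ip E" "ip (E x) x = of_real X" "ip (E y) y = of_real Y"
    "ip (E x) y + ip (E y) x = of_real B"
  shows "ip (E (c *\<^sub>R x + s *\<^sub>R y)) (c *\<^sub>R x + s *\<^sub>R y) = of_real (c\<^sup>2 * X + s\<^sup>2 * Y + c * s * B)"
proof -
  interpret E: bounded_linear E using assms(1) by (rule bounded_linear_self_adjoint)
  have "ip (E (c *\<^sub>R x + s *\<^sub>R y)) (c *\<^sub>R x + s *\<^sub>R y)
      = (of_real c)\<^sup>2 * ip (E x) x + (of_real s)\<^sup>2 * ip (E y) y
        + of_real c * of_real s * (ip (E x) y + ip (E y) x)"
    by (simp add: E.add E.scaleR ip_linear power2_eq_square algebra_simps)
  then show ?thesis by (simp add: assms)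
qed

text \<open>\<open>X\<close> prescribes the entries of the remainders \<open>w\<close>. Since a
  rotation preserves the sum of the two entries, the vector split off at step \<open>n\<close> gets
  what is left. The angles depend on the cross term with the current remainder, hence the dependent
  choice.\<close>

lemma rotation_chain_exists:
  fixes h :: "nat \<Rightarrow> 'a" and a X :: "nat \<Rightarrow> real"
  assumes E: "self_adjoint smul ip E"
    and a: "\<And>n. ip (E (h n)) (h n) = of_real (a n)"
    and X0: "X 0 = a 0"
    and seg: "\<And>n. X (Suc n) \<in> closed_segment (X n) (a (Suc n))"
  obtains w c s where "w 0 = h 0"
    "\<And>n. w (Suc n) = c n *\<^sub>R w n + s n *\<^sub>R h (Suc n)"
    "\<And>n. 0 \<le> c n" "\<And>n. (c n)\<^sup>2 + (s n)\<^sup>2 = 1"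
    "\<And>n. ip (E (w n)) (w n) = of_real (X n)"
    "\<And>n. ip (E (c n *\<^sub>R h (Suc n) - s n *\<^sub>R w n)) (c n *\<^sub>R h (Suc n) - s n *\<^sub>R w n)
      = of_real (X n + a (Suc n) - X (Suc n))"
    "\<And>n. X (Suc n) - X n \<le> (a (Suc n) - X n) * (s n)\<^sup>2"
    "\<And>n. X (Suc n) = X n \<Longrightarrow> s n = 0"
proof -
  define R where "R = (\<lambda>n w w' c s. w' = c *\<^sub>R w + s *\<^sub>R h (Suc n) \<and> 0 \<le> c \<and> c\<^sup>2 + s\<^sup>2 = 1
    \<and> ip (E (c *\<^sub>R h (Suc n) - s *\<^sub>R w)) (c *\<^sub>R h (Suc n) - s *\<^sub>R w)
      = of_real (X n + a (Suc n) - X (Suc n))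
    \<and> X (Suc n) - X n \<le> (a (Suc n) - X n) * s\<^sup>2 \<and> (X (Suc n) = X n \<longrightarrow> s = 0))"
  \<comment> \<open>The clause for \<open>n = 0\<close> pins down the start, which the choice
    principle would otherwise leave open.\<close>
  have "\<exists>w. \<forall>n. ((n = 0 \<longrightarrow> w n = h 0) \<and> ip (E (w n)) (w n) = of_real (X n))
    \<and> (\<exists>c s. R n (w n) (w (Suc n)) c s)"
  proof (rule dependent_nat_choice)
    show "\<exists>x. (0 = (0::nat) \<longrightarrow> x = h 0) \<and> ip (E x) x = of_real (X 0)"
      using a[of 0] X0 by auto
  next
    fix v n assume v: "(n = 0 \<longrightarrow> v = h 0) \<and> ip (E v) v = of_real (X n)"
    obtain B where B: "ip (E v) (h (Suc n)) + ip (E (h (Suc n))) v = of_real B"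
      using self_adjoint_polar_real[OF E] by blast
    obtain c s where cs: "0 \<le> c" "c\<^sup>2 + s\<^sup>2 = 1"
      "c\<^sup>2 * X n + s\<^sup>2 * a (Suc n) + c * s * B = X (Suc n)"
      "X (Suc n) - X n \<le> (a (Suc n) - X n) * s\<^sup>2" "X (Suc n) = X n \<Longrightarrow> s = 0"
      using rotation_parameters[OF seg[of n], of B] by blast
    note rot = ip_rotation[OF E v[THEN conjunct2] a[of "Suc n"] B]
    \<comment> \<open>The vector split off is the same kind of combination, with coefficients
      \<open>- s\<close> and \<open>c\<close>.\<close>
    have "ip (E (c *\<^sub>R h (Suc n) - s *\<^sub>R v)) (c *\<^sub>R h (Suc n) - s *\<^sub>R v)
        = of_real (s\<^sup>2 * X n + c\<^sup>2 * a (Suc n) - s * c * B)"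
      using rot[of "- s" c] by simp
    also have "s\<^sup>2 * X n + c\<^sup>2 * a (Suc n) - s * c * B = X n + a (Suc n) - X (Suc n)"
    proof -
      have s2: "s\<^sup>2 = 1 - c\<^sup>2" using cs(2) by simp
      show ?thesis unfolding cs(3)[symmetric] s2 by (simp add: algebra_simps)
    qed
    finally have "R n v (c *\<^sub>R v + s *\<^sub>R h (Suc n)) c s"
      unfolding R_def using cs by auto
    then show "\<exists>v'. ((Suc n = 0 \<longrightarrow> v' = h 0) \<and> ip (E v') v' = of_real (X (Suc n)))
        \<and> (\<exists>c s. R n v v' c s)"
      using rot[of c s] cs(3) by auto
  qed
  then obtain w where w: "\<And>n. n = 0 \<longrightarrow> w n = h 0" "\<And>n. ip (E (w n)) (w n) = of_real (X n)"
    and "\<And>n. \<exists>c s. R n (w n) (w (Suc n)) c s"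
    by blast
  then obtain c s where "\<And>n. R n (w n) (w (Suc n)) (c n) (s n)"
    by metis
  then show thesis
    using w by (intro that[of w c s]) (auto simp: R_def)
qed

end

section \<open>Completeness of the rotated system, which depends on the angles alone and not on the
  operator\<close>

locale rotation_chain = hilbert_space smul ip
  for smul :: "'k::real_or_complex \<Rightarrow> 'a::{real_normed_vector, complete_space} \<Rightarrow> 'a" and ip +
  fixes h w :: "nat \<Rightarrow> 'a" and c s :: "nat \<Rightarrow> real"
  assumes basis: "orthonormal_basis smul ip UNIV h"
    and w_0: "w 0 = h 0"
    and w_Suc: "w (Suc n) = c n *\<^sub>R w n + s n *\<^sub>R h (Suc n)"
    and c_nonneg: "0 \<le> c n"
    and c_s: "(c n)\<^sup>2 + (s n)\<^sup>2 = 1"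
begin

text \<open>The second vector of the rotated pair; later rotations leave it alone.\<close>

definition e where "e n = c n *\<^sub>R h (Suc n) - s n *\<^sub>R w n"

lemma ip_h: "ip (h i) (h j) = (if i = j then 1 else 0)"
  using basis by (simp add: orthonormal_basis_def)

lemma c_s_of_real: "of_real (c n) * of_real (c n) + of_real (s n) * of_real (s n) = (1::'k)"
  using arg_cong[OF c_s[of n], of "of_real :: _ \<Rightarrow> 'k"] by (simp add: power2_eq_square)

lemma c_le_1: "c n \<le> 1"
proof -
  have "(c n)\<^sup>2 \<le> 1\<^sup>2" using c_s[of n] zero_le_power2[of "s n"] unfolding one_power2 by linarith
  then show ?thesis by (rule power2_le_imp_le) simp
qed

lemma ip_w_h: "n < j \<Longrightarrow> ip (w n) (h j) = 0"
  by (induction n) (auto simp: w_0 w_Suc ip_h ip_linear)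

lemma ip_h_w: "n < j \<Longrightarrow> ip (h j) (w n) = 0"
  by (rule ip_zero_commute) (rule ip_w_h)

lemma ip_w_w: "ip (w n) (w n) = 1"
proof (induction n)
  case (Suc n)
  then show ?case
    using c_s_of_real[of n] by (simp add: w_Suc ip_linear ip_w_h ip_h_w ip_h)
qed (simp add: w_0 ip_h)

lemma norm_w: "norm (w n) = 1"
  by (intro norm_eq_1_if_ip_self ip_w_w)

lemma ip_e_e_same: "ip (e n) (e n) = 1"
  using c_s_of_real[of n] by (simp add: e_def ip_linear ip_w_h ip_h_w ip_h ip_w_w)

text \<open>The rotation makes \<open>w (Suc n)\<close> orthogonal to \<open>e n\<close>; later
  remainders only add vectors \<open>h j\<close> with \<open>j > Suc n\<close>, which are orthogonal
  to both constituents of \<open>e n\<close>.\<close>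

lemma ip_w_e: "n < m \<Longrightarrow> ip (w m) (e n) = 0"
proof (induction m)
  case (Suc m)
  have e_h: "ip (h (Suc m)) (e n) = 0" if "n < m"
    using that by (simp add: e_def ip_linear ip_h ip_h_w)
  show ?case
  proof (cases "n = m")
    case True
    then show ?thesis by (simp add: w_Suc e_def ip_linear ip_h ip_h_w ip_w_h ip_w_w)
  next
    case False
    then show ?thesis using Suc e_h by (simp add: w_Suc ip_linear)
  qed
qed simp

lemma ip_e_e_less: "n < m \<Longrightarrow> ip (e m) (e n) = 0"
  using ip_w_e[of n m] by (simp add: e_def[of m] ip_linear) (simp add: e_def ip_linear ip_h ip_h_w)

lemma ip_e_e: "ip (e m) (e n) = (if m = n then 1 else 0)"
  using ip_e_e_less[of m n] ip_e_e_less[of n m] ip_e_e_same[of n] ip_zero_commute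
  by (metis linorder_neqE_nat)

text \<open>This and \<open>w_eq\<close> are the inverse rotation.\<close>

lemma h_Suc_eq: "h (Suc n) = s n *\<^sub>R w (Suc n) + c n *\<^sub>R e n"
proof -
  have "s n *\<^sub>R w (Suc n) + c n *\<^sub>R e n = ((c n)\<^sup>2 + (s n)\<^sup>2) *\<^sub>R h (Suc n)"
    by (simp add: w_Suc e_def algebra_simps power2_eq_square)
  then show ?thesis by (simp add: c_s)
qed

lemma w_eq: "w n = c n *\<^sub>R w (Suc n) - s n *\<^sub>R e n"
proof -
  have "c n *\<^sub>R w (Suc n) - s n *\<^sub>R e n = ((c n)\<^sup>2 + (s n)\<^sup>2) *\<^sub>R w n"
    by (simp add: w_Suc e_def algebra_simps power2_eq_square)
  then show ?thesis by (simp add: c_s)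
qed

text \<open>Modulo the span of the \<open>e\<^sub>n\<close>, rotating merely scales the remainder by the cosine.\<close>

lemma w_diff_in_span: "w k - (\<Prod>j\<in>{k..<k+m}. c j) *\<^sub>R w (k + m) \<in> span (range e)"
proof (induction m)
  case (Suc m)
  let ?P = "\<Prod>j\<in>{k..<k+m}. c j"
  have eq: "w k - (\<Prod>j\<in>{k..<k+Suc m}. c j) *\<^sub>R w (k + Suc m)
      = (w k - ?P *\<^sub>R w (k + m)) - (?P * s (k + m)) *\<^sub>R e (k + m)"
    by (subst w_eq[of "k + m"]) (simp add: algebra_simps)
  show ?case
    unfolding eq by (intro span_diff span_scaleR Suc span_base) simp
qed (simp add: span_zero)

text \<open>By the inverse rotation the remainders and the \<open>e n\<close> give back the basis
  \<open>h\<close>. The set \<open>B\<close> is kept general to allow for an additional limit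
  vector.\<close>

lemma closure_span_UNIV_if_contains_w:
  assumes "range e \<subseteq> B" and "\<And>k. w k \<in> closure (span B)"
  shows "closure (span B) = UNIV"
proof (rule closure_span_eq_UNIV)
  show "closure (span (range h)) = UNIV"
    using basis by (simp add: orthonormal_basis_def)
  have sub: "subspace (closure (span B))" by (intro subspace_closure subspace_span)
  have scaleR: "r *\<^sub>R x \<in> closure (span B)" if "x \<in> closure (span B)" for r x
    using subspace_scale[OF sub that, of "of_real r"] by (simp add: smul_of_real)
  have "e n \<in> closure (span B)" for n
    using assms(1) span_superset closure_subset by blast
  then have "h n \<in> closure (span B)" for n
    using assms(2) w_0 by (cases n) (metis, simp add: h_Suc_eq subspace_add[OF sub] scaleR)
  then show "range h \<subseteq> closure (span B)" by blast
qed

lemma prod_c_nonneg: "0 \<le> (\<Prod>j\<in>{k..<k+m}. c j)"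
  by (simp add: prod_nonneg c_nonneg)

lemma decseq_prod_c: "decseq (\<lambda>m. \<Prod>j\<in>{k..<k+m}. c j)"
proof (rule decseq_SucI)
  fix m show "(\<Prod>j\<in>{k..<k+Suc m}. c j) \<le> (\<Prod>j\<in>{k..<k+m}. c j)"
    using mult_left_le[OF c_le_1[of "k + m"] prod_c_nonneg[of k m]] by simp
qed

lemma prod_c_tendsto: obtains L where "(\<lambda>m. \<Prod>j\<in>{k..<k+m}. c j) \<longlonglongrightarrow> L"
  using decseq_convergent[OF decseq_prod_c, of 0 k] prod_c_nonneg by blast

text \<open>If the decreasing products of cosines had a positive limit, quotients of successive
  products, which are the cosines, would tend to 1. So they tend to 0, and as remainders are unit
  vectors, \<open>w_diff_in_span\<close> puts each \<open>w k\<close> into the closed span of the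
  \<open>e n\<close>.\<close>

lemma orthonormal_basis_e:
  assumes "r < 1" and "\<exists>\<^sub>\<infinity>n. c n \<le> r"
  shows "orthonormal_basis smul ip UNIV e"
proof -
  have "w k \<in> closure (span (range e))" for k
  proof -
    let ?P = "\<lambda>m. \<Prod>j\<in>{k..<k+m}. c j"
    note nonneg = prod_c_nonneg[of k]
    have P_Suc: "?P (Suc m) = ?P m * c (k + m)" for m by simp
    obtain L where L: "?P \<longlonglongrightarrow> L" using prod_c_tendsto by blast
    have "L = 0"
    proof (rule ccontr)
      assume "L \<noteq> 0"
      have "0 \<le> L" using LIMSEQ_le_const[OF L] nonneg by blast
      with \<open>L \<noteq> 0\<close> have "L > 0" by simp
      have "(\<lambda>m. ?P (Suc m) / ?P m) \<longlonglongrightarrow> L / L"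
        by (intro tendsto_divide LIMSEQ_Suc L \<open>L \<noteq> 0\<close>)
      moreover have "?P m > 0" for m
        using decseq_ge[OF decseq_prod_c L, of m] \<open>L > 0\<close> by linarith
      then have "?P (Suc m) / ?P m = c (k + m)" for m
        unfolding P_Suc by (metis less_irrefl nonzero_mult_div_cancel_left)
      ultimately have "(\<lambda>m. c (k + m)) \<longlonglongrightarrow> 1" using \<open>L \<noteq> 0\<close> by simp
      then have "c \<longlonglongrightarrow> 1" using LIMSEQ_offset[of c k] by (simp add: add.commute)
      then have "eventually (\<lambda>n. c n > r) sequentially"
        using assms(1) by (rule order_tendstoD)
      then have "\<forall>\<^sub>\<infinity>n. \<not> c n \<le> r" by (simp add: cofinite_eq_sequentially not_le)
      then show False using assms(2) by (simp add: frequently_def)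
    qed
    have "norm (?P m *\<^sub>R w (k + m)) = ?P m" for m
      using nonneg[of m] by (simp only: norm_scaleR norm_w abs_of_nonneg mult_1_right)
    with L \<open>L = 0\<close> have "(\<lambda>m. norm (?P m *\<^sub>R w (k + m))) \<longlonglongrightarrow> 0"
      by (simp only:)
    then have "(\<lambda>m. ?P m *\<^sub>R w (k + m)) \<longlonglongrightarrow> 0"
      by (rule tendsto_norm_zero_cancel)
    with w_diff_in_span have "w k - 0 \<in> closure (span (range e))"
      by (rule in_closure_if_tendsto)
    then show ?thesis by simp
  qed
  then show ?thesis
    using closure_span_UNIV_if_contains_w[of "range e"] by (simp add: orthonormal_basis_def ip_e_e)
qed

lemma norm_w_diff: "norm (w (Suc n) - w n) \<le> 2 * \<bar>s n\<bar>"
proof -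
  have "1 - c n \<le> \<bar>s n\<bar>"
  proof -
    have "1 = (c n)\<^sup>2 + \<bar>s n\<bar>\<^sup>2" using c_s[of n] by simp
    also have "\<dots> \<le> (c n + \<bar>s n\<bar>)\<^sup>2" using c_nonneg[of n] by (simp add: power2_sum)
    finally have "1 \<le> c n + \<bar>s n\<bar>"
      using c_nonneg[of n] by (intro power2_le_imp_le[of 1]) auto
    then show ?thesis by simp
  qed
  moreover have "norm (h (Suc n)) = 1"
    by (intro norm_eq_1_if_ip_self) (simp add: ip_h)
  moreover have "w (Suc n) - w n = (c n - 1) *\<^sub>R w n + s n *\<^sub>R h (Suc n)"
    by (simp add: w_Suc algebra_simps)
  then have "norm (w (Suc n) - w n) \<le> \<bar>c n - 1\<bar> * norm (w n) + \<bar>s n\<bar> * norm (h (Suc n))"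
    by (metis norm_scaleR norm_triangle_ineq)
  ultimately show ?thesis using c_le_1[of n] by (simp add: norm_w)
qed

text \<open>Each step of \<open>w\<close> has length at most \<open>2 * \<bar>s n\<bar>\<close>, so
  \<open>w\<close> is Cauchy. Modulo the closed span of the \<open>e n\<close>, every
  \<open>w k\<close> is the multiple \<open>L\<close> of the limit \<open>v\<close>; the argument
  does not ask whether \<open>L\<close> is 0.\<close>

lemma orthonormal_basis_limit_e:
  assumes "summable (\<lambda>n. \<bar>s n\<bar>)"
  obtains v where "w \<longlonglongrightarrow> v" "orthonormal_basis smul ip UNIV (case_nat v e)"
proof -
  interpret ip: bounded_bilinear ip by (rule bounded_bilinear_ip)
  define T where "T n = (\<Sum>j<n. 2 * \<bar>s j\<bar>)" for n
  have dist_le: "dist (w m) (w (m + k)) \<le> T (m + k) - T m" for m k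
  proof (induction k)
    case (Suc k)
    have "dist (w m) (w (m + Suc k)) \<le> dist (w m) (w (m + k)) + dist (w (m + k)) (w (Suc (m + k)))"
      by (simp add: dist_triangle)
    then show ?case
      using Suc norm_w_diff[of "m + k"] by (simp add: T_def dist_norm norm_minus_commute)
  qed simp
  have "convergent T"
    using summable_mult[OF assms, of 2] unfolding T_def[abs_def] summable_iff_convergent .
  then have "Cauchy T" by (rule convergent_Cauchy)
  have "Cauchy w"
  proof (rule metric_CauchyI)
    fix \<epsilon> :: real assume "0 < \<epsilon>"
    then obtain M where M: "\<And>m n. M \<le> m \<Longrightarrow> M \<le> n \<Longrightarrow> dist (T m) (T n) < \<epsilon>"
      using \<open>Cauchy T\<close> unfolding Cauchy_def by blast
    have "dist (w m) (w n) < \<epsilon>" if "M \<le> m" "m \<le> n" for m n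
      using dist_le[of m "n - m"] M[of m n] that by (simp add: dist_real_def)
    then show "\<exists>M. \<forall>m\<ge>M. \<forall>n\<ge>M. dist (w m) (w n) < \<epsilon>"
      by (metis dist_commute nle_le)
  qed
  then obtain v where v: "w \<longlonglongrightarrow> v"
    using Cauchy_convergent convergent_def by blast
  have v_e: "ip v (e n) = 0" for n
  proof -
    have "(\<lambda>m. ip (w m) (e n)) \<longlonglongrightarrow> ip v (e n)" by (intro ip.tendsto v tendsto_const)
    moreover have "eventually (\<lambda>m. ip (w m) (e n) = 0) sequentially"
      using eventually_gt_at_top[of n] by eventually_elim (rule ip_w_e)
    then have "(\<lambda>m. ip (w m) (e n)) \<longlonglongrightarrow> 0" by (rule tendsto_eventually)
    ultimately show ?thesis by (rule LIMSEQ_unique)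
  qed
  have "(\<lambda>m. ip (w m) (w m)) \<longlonglongrightarrow> ip v v" by (intro ip.tendsto v)
  then have v_v: "ip v v = 1" by (simp add: ip_w_w LIMSEQ_const_iff)
  let ?B = "range (case_nat v e)"
  have range_B: "?B = insert v (range e)"
    by (auto simp: image_iff split: nat.splits)
  have "w k \<in> closure (span ?B)" for k
  proof -
    let ?P = "\<lambda>m. \<Prod>j\<in>{k..<k+m}. c j"
    obtain L where L: "?P \<longlonglongrightarrow> L" using prod_c_tendsto by blast
    have "(\<lambda>m. ?P m *\<^sub>R w (k + m)) \<longlonglongrightarrow> L *\<^sub>R v"
      using LIMSEQ_ignore_initial_segment[OF v, of k] by (intro tendsto_scaleR L) (simp add: add.commute)
    with w_diff_in_span have "w k - L *\<^sub>R v \<in> closure (span (range e))"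
      by (rule in_closure_if_tendsto)
    then have "w k - L *\<^sub>R v \<in> closure (span ?B)"
      unfolding range_B using closure_mono[OF span_mono] by (metis subsetD subset_insertI)
    moreover have "L *\<^sub>R v \<in> closure (span ?B)"
      unfolding range_B by (intro subsetD[OF closure_subset] span_scaleR span_base) simp
    ultimately show ?thesis
      using subspace_add[OF subspace_closure[OF subspace_span]] by fastforce
  qed
  then have "closure (span ?B) = UNIV"
    by (intro closure_span_UNIV_if_contains_w) (auto simp: range_B)
  moreover have "ip (case_nat v e i) (case_nat v e j) = (if i = j then 1 else 0)" for i j
    using v_v v_e ip_zero_commute[OF v_e] by (auto simp: ip_e_e split: nat.splits)
  ultimately show thesis
    using v by (intro that[of v]) (auto simp: orthonormal_basis_def)
qed

end


section \<open>Two ways of moving diagonal entries\<close>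

context hilbert_space
begin

lemma is_diagonal_permute:
  assumes "is_diagonal smul ip UNIV a E" "bij \<pi>"
  shows "is_diagonal smul ip UNIV (a \<circ> \<pi>) E"
proof -
  obtain h where h: "orthonormal_basis smul ip UNIV h" "\<And>i. ip (E (h i)) (h i) = of_real (a i)"
    using assms(1) by (auto simp: is_diagonal_def)
  have "range (h \<circ> \<pi>) = range h" using assms(2) by (metis bij_is_surj image_comp)
  moreover have "inj \<pi>" using assms(2) by (rule bij_is_inj)
  ultimately have "orthonormal_basis smul ip UNIV (h \<circ> \<pi>)"
    using h(1) by (simp add: orthonormal_basis_def inj_eq)
  then show ?thesis using h(2) by (auto simp: is_diagonal_def)
qed

text \<open>The entry at 0 gives away the amounts \<open>\<delta> n\<close> one after another. Where
  \<open>\<delta> n\<close> is positive, the remainder stays above \<open>a (Suc n)\<close> by at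
  least \<open>g\<close>, so the squared sine is at most \<open>\<delta> n / g\<close>; elsewhere
  nothing is rotated. Summability of the square roots thus makes the sines summable.\<close>

lemma is_diagonal_spread:
  fixes a \<delta> :: "nat \<Rightarrow> real"
  assumes E: "self_adjoint smul ip E"
    and diag: "is_diagonal smul ip UNIV a E"
    and nonneg: "\<And>n. 0 \<le> \<delta> n"
    and summable: "summable \<delta>" "summable (\<lambda>n. sqrt (\<delta> n))"
    and gap: "0 < g" "\<And>n. 0 < \<delta> n \<Longrightarrow> a (Suc n) + g \<le> a 0 - suminf \<delta>"
  shows "is_diagonal smul ip UNIV (case_nat (a 0 - suminf \<delta>) (\<lambda>n. a (Suc n) + \<delta> n)) E"
proof -
  obtain h where h: "orthonormal_basis smul ip UNIV h" "\<And>i. ip (E (h i)) (h i) = of_real (a i)"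
    using diag by (auto simp: is_diagonal_def)
  define X where "X n = a 0 - sum \<delta> {..<n}" for n
  have X_Suc: "X (Suc n) = X n - \<delta> n" for n by (simp add: X_def)
  have X_ge: "a 0 - suminf \<delta> \<le> X n" for n
    using sum_le_suminf[OF summable(1), of "{..<n}"] nonneg by (simp add: X_def)
  have seg: "X (Suc n) \<in> closed_segment (X n) (a (Suc n))" for n
  proof (cases "\<delta> n = 0")
    case True
    then show ?thesis by (simp add: X_Suc)
  next
    case False
    then have "a (Suc n) \<le> X (Suc n)" "X (Suc n) \<le> X n"
      using gap(1) gap(2)[of n] nonneg[of n] X_ge[of "Suc n"] by (simp_all add: X_Suc)
    then show ?thesis by (simp add: closed_segment_eq_real_ivl)
  qed
  obtain w c s where wcs: "w 0 = h 0"
    "\<And>n. w (Suc n) = c n *\<^sub>R w n + s n *\<^sub>R h (Suc n)"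
    "\<And>n. 0 \<le> c n" "\<And>n. (c n)\<^sup>2 + (s n)\<^sup>2 = 1"
    and w_diag: "\<And>n. ip (E (w n)) (w n) = of_real (X n)"
    and e_diag: "\<And>n. ip (E (c n *\<^sub>R h (Suc n) - s n *\<^sub>R w n)) (c n *\<^sub>R h (Suc n) - s n *\<^sub>R w n)
      = of_real (X n + a (Suc n) - X (Suc n))"
    and s: "\<And>n. X (Suc n) - X n \<le> (a (Suc n) - X n) * (s n)\<^sup>2"
    "\<And>n. X (Suc n) = X n \<Longrightarrow> s n = 0"
    using rotation_chain_exists[of E h a X, OF E h(2) _ seg] by (auto simp: X_def)
  interpret rotation_chain smul ip h w c s
    by unfold_locales (use h(1) wcs in auto)
  have "\<bar>s n\<bar> \<le> sqrt (\<delta> n) / sqrt g" for n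
  proof (cases "\<delta> n = 0")
    case True
    then show ?thesis using s(2)[of n] by (simp add: X_Suc)
  next
    case False
    then have "g \<le> X n - a (Suc n)"
      using gap(2)[of n] nonneg[of n] X_ge[of n] by simp
    then have "g * (s n)\<^sup>2 \<le> (X n - a (Suc n)) * (s n)\<^sup>2" by (rule mult_right_mono) simp
    also have "\<dots> \<le> \<delta> n" using s(1)[of n] by (simp add: X_Suc algebra_simps)
    finally have "(s n)\<^sup>2 \<le> \<delta> n / g" using gap(1) by (simp add: pos_le_divide_eq mult.commute)
    then show ?thesis unfolding real_sqrt_divide[symmetric] by (intro real_le_rsqrt) simp
  qed
  then have "summable (\<lambda>n. \<bar>s n\<bar>)"
    by (intro summable_comparison_test[OF _ summable_divide[OF summable(2), of "sqrt g"]]) simp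
  then obtain v where v: "w \<longlonglongrightarrow> v" "orthonormal_basis smul ip UNIV (case_nat v e)"
    using orthonormal_basis_limit_e by blast
  have "(\<lambda>n. ip (E (w n)) (w n)) \<longlonglongrightarrow> ip (E v) v"
    by (intro bounded_bilinear.tendsto[OF bounded_bilinear_ip]
        bounded_linear.tendsto[OF bounded_linear_self_adjoint[OF E]] v(1))
  moreover have "X \<longlonglongrightarrow> a 0 - suminf \<delta>"
    unfolding X_def[abs_def] by (intro tendsto_diff tendsto_const summable_LIMSEQ summable)
  then have "(\<lambda>n. of_real (X n)) \<longlonglongrightarrow> (of_real (a 0 - suminf \<delta>) :: 'k)"
    by (rule tendsto_of_real)
  ultimately have "ip (E v) v = of_real (a 0 - suminf \<delta>)"
    unfolding w_diag by (rule LIMSEQ_unique)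
  moreover have "ip (E (e n)) (e n) = of_real (a (Suc n) + \<delta> n)" for n
    unfolding e_def e_diag by (simp add: X_Suc)
  ultimately have "ip (E (case_nat v e i)) (case_nat v e i)
      = of_real (case_nat (a 0 - suminf \<delta>) (\<lambda>n. a (Suc n) + \<delta> n) i)" for i
    by (cases i) simp_all
  then show ?thesis using v(2) unfolding is_diagonal_def by blast
qed

text \<open>The remainders get the entries \<open>- T n\<close>, with \<open>T n\<close> the tail of
  the excesses, so that exactly \<open>d n\<close> is split off. The squared sine is at least
  \<open>(y n - d n) / (y n + T n)\<close>, and \<open>freq\<close> keeps infinitely many cosines
  away from 1.\<close>

lemma is_diagonal_absorb:
  fixes y d :: "nat \<Rightarrow> real"
  assumes E: "self_adjoint smul ip E"
    and diag: "is_diagonal smul ip UNIV (case_nat (- S) y) E"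
    and y: "\<And>n. 0 < y n" and d: "\<And>n. 0 \<le> d n" "\<And>n. d n \<le> y n"
    and S: "(\<lambda>n. y n - d n) sums S"
    and \<rho>: "0 < \<rho>"
    and freq: "\<exists>\<^sub>\<infinity>n. \<rho> * (y n + (\<Sum>j. y (j + n) - d (j + n))) \<le> y n - d n"
  shows "is_diagonal smul ip UNIV d E"
proof -
  obtain h where h: "orthonormal_basis smul ip UNIV h"
    "\<And>i. ip (E (h i)) (h i) = of_real (case_nat (- S) y i)"
    using diag by (auto simp: is_diagonal_def)
  define T where "T n = (\<Sum>j. y (j + n) - d (j + n))" for n
  have summable: "summable (\<lambda>j. y (j + n) - d (j + n))" for n
    using sums_summable[OF S] by (rule summable_ignore_initial_segment)
  have T_0: "T 0 = S" using S by (simp add: T_def sums_iff)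
  have T_Suc: "T (Suc n) = T n - (y n - d n)" for n
    using suminf_split_head[OF summable[of n]] by (simp add: T_def)
  have T_nonneg: "0 \<le> T n" for n
    unfolding T_def by (intro suminf_nonneg summable) (simp add: d)
  have X_0: "- T 0 = case_nat (- S) y 0" by (simp add: T_0)
  \<comment> \<open>The entries \<open>- T n\<close> increase and stay at most 0, below every
    \<open>y n\<close>.\<close>
  have seg: "- T (Suc n) \<in> closed_segment (- T n) (case_nat (- S) y (Suc n))" for n
    using T_nonneg[of n] T_nonneg[of "Suc n"] T_Suc[of n] y[of n] d[of n]
    by (auto simp: closed_segment_eq_real_ivl)
  obtain w c s where wcs: "w 0 = h 0"
    "\<And>n. w (Suc n) = c n *\<^sub>R w n + s n *\<^sub>R h (Suc n)"
    "\<And>n. 0 \<le> c n" "\<And>n. (c n)\<^sup>2 + (s n)\<^sup>2 = 1"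
    and e_diag: "\<And>n. ip (E (c n *\<^sub>R h (Suc n) - s n *\<^sub>R w n)) (c n *\<^sub>R h (Suc n) - s n *\<^sub>R w n)
      = of_real (- T n + case_nat (- S) y (Suc n) - - T (Suc n))"
    and s: "\<And>n. - T (Suc n) - - T n \<le> (case_nat (- S) y (Suc n) - - T n) * (s n)\<^sup>2"
    by (rule rotation_chain_exists[of E h "case_nat (- S) y" "\<lambda>n. - T n", OF E h(2) X_0 seg])
      (rule that)
  interpret rotation_chain smul ip h w c s
    by unfold_locales (use h(1) wcs in auto)
  have "\<exists>\<^sub>\<infinity>n. c n \<le> sqrt (1 - \<rho>)"
    using freq
  proof (rule INFM_mono)
    fix n assume "\<rho> * (y n + (\<Sum>j. y (j + n) - d (j + n))) \<le> y n - d n"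
    then have "\<rho> * (y n + T n) \<le> (s n)\<^sup>2 * (y n + T n)"
      using s[of n] by (simp add: T_Suc mult.commute flip: T_def)
    then have "\<rho> \<le> (s n)\<^sup>2" using y[of n] T_nonneg[of n] by simp
    then have "(c n)\<^sup>2 \<le> 1 - \<rho>" using wcs(4)[of n] by linarith
    then show "c n \<le> sqrt (1 - \<rho>)" by (rule real_le_rsqrt)
  qed
  then have "orthonormal_basis smul ip UNIV e"
    using \<rho> by (intro orthonormal_basis_e[of "sqrt (1 - \<rho>)"]) simp_all
  moreover have "ip (E (e n)) (e n) = of_real (d n)" for n
    unfolding e_def e_diag by (simp add: T_Suc)
  ultimately show ?thesis unfolding is_diagonal_def by blast
qed

end

section \<open>Choice of the portions and combination of the two chains\<close>

lemma suminf_tail_tendsto_0: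
  fixes f :: "nat \<Rightarrow> real"
  assumes "summable f"
  shows "(\<lambda>n. \<Sum>j. f (j + n)) \<longlonglongrightarrow> 0"
  unfolding suminf_minus_initial_segment[OF assms]
  using tendsto_diff[OF tendsto_const summable_LIMSEQ[OF assms], of "suminf f"] by simp

text \<open>However sparse \<open>m\<close> is, the tail from \<open>m k\<close> on is only the
  constant factor \<open>1 / (1 - r)\<close> larger than the portion at \<open>m k\<close>.\<close>

lemma geometric_on_subsequence:
  fixes m :: "nat \<Rightarrow> nat" and r \<eta> :: real
  assumes m: "strict_mono m" and r: "0 \<le> r" "r < 1"
  obtains \<delta> where "\<And>k. \<delta> (m k) = \<eta> * r ^ k" "\<And>n. n \<notin> range m \<Longrightarrow> \<delta> n = 0"
    "\<And>k. (\<lambda>j. \<delta> (j + m k)) sums (\<eta> * r ^ k / (1 - r))" "\<delta> sums (\<eta> / (1 - r))"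
proof -
  define \<delta> where "\<delta> n = (if n \<in> range m then \<eta> * r ^ (inv m n) else 0)" for n
  have \<delta>_m: "\<delta> (m k) = \<eta> * r ^ k" for k
    using m by (simp add: \<delta>_def strict_mono_imp_inj_on)
  have geo: "(\<lambda>l. r ^ l) sums (1 / (1 - r))" using r by (intro geometric_sums) simp
  have tail: "(\<lambda>j. \<delta> (j + m k)) sums (\<eta> * r ^ k / (1 - r))" for k
  proof -
    \<comment> \<open>Enumerates the members of \<open>range m\<close> from \<open>m k\<close> on,
      shifted by \<open>m k\<close>.\<close>
    define g where "g l = m (k + l) - m k" for l
    have m_g: "g l + m k = m (k + l)" for l
      using strict_mono_mono[OF m] by (simp add: g_def monoD)
    have "strict_mono g"
      by (rule strict_monoI) (use m_g strict_monoD[OF m] in \<open>metis add_less_cancel_left add_less_cancel_right\<close>)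
    moreover have "\<delta> (j + m k) = 0" if "j \<notin> range g" for j
    proof -
      have "j + m k \<noteq> m l" for l
      proof
        assume eq: "j + m k = m l"
        then have "m k \<le> m l" by simp
        then have "k \<le> l" using m strict_mono_less_eq by blast
        then have "j = g (l - k)" using eq by (simp add: g_def flip: eq)
        then show False using that by blast
      qed
      then show ?thesis by (auto simp: \<delta>_def)
    qed
    moreover have "(\<lambda>l. \<delta> (g l + m k)) sums (\<eta> * r ^ k / (1 - r))"
      using sums_mult[OF geo, of "\<eta> * r ^ k"] by (simp add: m_g \<delta>_m power_add mult_ac)
    ultimately show ?thesis using sums_mono_reindex[of g "\<lambda>j. \<delta> (j + m k)"] by blast
  qed
  have "(\<lambda>l. \<delta> (m l)) sums (\<eta> / (1 - r))"
    using sums_mult[OF geo, of \<eta>] by (simp add: \<delta>_m)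
  then have "\<delta> sums (\<eta> / (1 - r))"
    using sums_mono_reindex[OF m, of \<delta>] by (auto simp: \<delta>_def)
  then show thesis using \<delta>_m tail by (intro that[of \<delta>]) (auto simp: \<delta>_def)
qed

theorem theorem4p9:
  fixes smul :: "'k::real_or_complex \<Rightarrow> 'a::{real_normed_vector, complete_space} \<Rightarrow> 'a"
    and ip :: "'a \<Rightarrow> 'a \<Rightarrow> 'k"
    and E :: "'a \<Rightarrow> 'a"
    and lam d :: "nat \<Rightarrow> real"
    and lam_neg :: real
  assumes "hilbert_space smul ip"
    and "separable_space (euclidean :: 'a topology)"
    and "\<And>i. lam i > 0"
    and "\<And>i. d i > 0"
    and "lam \<longlonglongrightarrow> 0"
    and "d \<longlonglongrightarrow> 0"
    and "\<And>i. lam i \<ge> d i"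
    and "(\<lambda>i. lam i - d i) sums lam_neg"
    and "lam_neg > 0"
    and "self_adjoint smul ip E"
    and "is_diagonal smul ip UNIV (case_nat (- lam_neg) lam) E"
  shows "is_diagonal smul ip UNIV d E"
proof -
  interpret hilbert_space smul ip by fact
  note lam_pos = assms(3) and d_pos = assms(4) and lam_lim = assms(5) and d_le = assms(7)
    and sums = assms(8) and E = assms(10) and diag = assms(11)
  have "\<exists>i. d i < lam i"
  proof (rule ccontr)
    assume "\<not> ?thesis"
    then have "lam i - d i = 0" for i using d_le[of i] by (simp add: not_less antisym)
    then have "(\<lambda>i. lam i - d i) sums 0" by (simp only: sums_zero)
    from sums_unique2[OF this sums] show False using assms(9) by simp
  qed
  then obtain i where i: "d i < lam i" ..
  \<comment> \<open>With ratio 1/4 the portions add up to \<open>4/3 * \<eta>\<close>, a third of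
    the excess at \<open>i\<close>, and their square roots are geometric with ratio 1/2.\<close>
  define \<eta> where "\<eta> = (lam i - d i) / 4"
  define q where "q k = \<eta> * (1/4) ^ k" for k
  have \<eta>: "0 < \<eta>" using i by (simp add: \<eta>_def)
  then have q_pos: "0 < q k" for k by (simp add: q_def)
  have q_le: "q k \<le> \<eta>" for k
    unfolding q_def using \<eta> by (intro mult_left_le power_le_one) auto
  \<comment> \<open>The condition \<open>i < n\<close> keeps \<open>i\<close> out of
    \<open>range m\<close>, so no portion is sent to the index \<open>Suc i\<close> where the swap
    below parks the negative entry.\<close>
  define Q where "Q k n \<longleftrightarrow> i < n \<and> lam n \<le> q k \<and> (\<Sum>j. lam (j + n) - d (j + n)) \<le> q k" for k n
  have "eventually (Q k) sequentially" for k
  proof -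
    have "eventually (\<lambda>n. lam n < q k) sequentially"
      using lam_lim q_pos by (rule order_tendstoD)
    moreover have "eventually (\<lambda>n. (\<Sum>j. lam (j + n) - d (j + n)) < q k) sequentially"
      using suminf_tail_tendsto_0[OF sums_summable[OF sums]] q_pos by (rule order_tendstoD)
    ultimately show ?thesis
      using eventually_gt_at_top[of i] by eventually_elim (simp add: Q_def)
  qed
  then have Q_ex: "\<exists>n>N. Q k n" for N k
    using eventually_happens'[OF sequentially_bot eventually_conj[OF eventually_gt_at_top[of N]]]
    by blast
  have "\<exists>m. \<forall>k. Q k (m k) \<and> m k < m (Suc k)"
    by (rule dependent_nat_choice) (use Q_ex in blast)+
  then obtain m where Q: "\<And>k. Q k (m k)" and m: "strict_mono m"
    by (auto simp: strict_mono_Suc_iff)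
  obtain \<delta> where \<delta>_m: "\<And>k. \<delta> (m k) = q k" and \<delta>_0: "\<And>n. n \<notin> range m \<Longrightarrow> \<delta> n = 0"
    and \<delta>_tail: "\<And>k. (\<lambda>j. \<delta> (j + m k)) sums (4/3 * q k)" and \<delta>_sums: "\<delta> sums (4/3 * \<eta>)"
    using geometric_on_subsequence[OF m, of "1/4" \<eta>] by (auto simp: q_def mult_ac)
  have \<delta>_nonneg: "0 \<le> \<delta> n" for n
    using \<delta>_0 \<delta>_m q_pos by (cases "n \<in> range m") (auto simp: less_imp_le)
  have suminf_\<delta>: "suminf \<delta> = 4/3 * \<eta>" using \<delta>_sums by (simp add: sums_iff)
  have \<delta>_i: "\<delta> i = 0" using Q by (intro \<delta>_0) (force simp: Q_def)
  \<comment> \<open>The spread has to start from \<open>lam i\<close>, which sits at index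
    \<open>Suc i\<close> behind the negative entry.\<close>
  define \<pi> where "\<pi> = id(0 := Suc i, Suc i := 0)"
  have "bij \<pi>" by (rule involuntory_imp_bij) (simp add: \<pi>_def)
  define a where "a = case_nat (- lam_neg) lam \<circ> \<pi>"
  have a_0: "a 0 = lam i" and a_Suc: "a (Suc n) = (if n = i then - lam_neg else lam n)" for n
    by (simp_all add: a_def \<pi>_def)
  have "is_diagonal smul ip UNIV a E"
    unfolding a_def using diag \<open>bij \<pi>\<close> by (rule is_diagonal_permute)
  then have "is_diagonal smul ip UNIV (case_nat (a 0 - suminf \<delta>) (\<lambda>n. a (Suc n) + \<delta> n)) E"
  proof (rule is_diagonal_spread[OF E _ \<delta>_nonneg])
    show "summable \<delta>" using \<delta>_sums by (rule sums_summable)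
    have "summable (\<lambda>k. sqrt \<eta> * (1/2) ^ k)" by (intro summable_mult summable_geometric) simp
    then have "summable (\<lambda>k. sqrt (\<delta> (m k)))"
      by (simp add: \<delta>_m q_def real_sqrt_mult real_sqrt_power real_sqrt_divide)
    then show "summable (\<lambda>n. sqrt (\<delta> n))"
      using summable_mono_reindex[OF m, of "\<lambda>n. sqrt (\<delta> n)"] \<delta>_0 by simp
    show "0 < lam i / 4" using lam_pos by simp
    fix n assume "0 < \<delta> n"
    then obtain k where "n = m k" using \<delta>_0 by force
    \<comment> \<open>At least two thirds of \<open>lam i\<close> survive the spread and
      \<open>lam n\<close> is at most a quarter of it, which leaves room for the gap
      \<open>lam i / 4\<close>.\<close>
    then have "lam n \<le> \<eta>" "n \<noteq> i" using Q[of k] q_le[of k] by (auto simp: Q_def)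
    then show "a (Suc n) + lam i / 4 \<le> a 0 - suminf \<delta>"
      using lam_pos[of i] d_pos[of i] by (simp add: a_0 a_Suc suminf_\<delta> \<eta>_def field_simps)
  qed
  \<comment> \<open>Swapping back returns the negative entry, unchanged, to the front and the
    reduced entry to \<open>i\<close>.\<close>
  from is_diagonal_permute[OF this \<open>bij \<pi>\<close>]
  have diag': "is_diagonal smul ip UNIV
      (case_nat (a 0 - suminf \<delta>) (\<lambda>n. a (Suc n) + \<delta> n) \<circ> \<pi>) E" .
  define y where "y n = (if n = i then lam i - suminf \<delta> else lam n + \<delta> n)" for n
  have "case_nat (a 0 - suminf \<delta>) (\<lambda>n. a (Suc n) + \<delta> n) \<circ> \<pi> = case_nat (- lam_neg) y"
    by (rule ext) (auto simp: \<pi>_def y_def a_0 a_Suc \<delta>_i split: nat.splits)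
  with diag' have "is_diagonal smul ip UNIV (case_nat (- lam_neg) y) E" by simp
  then show ?thesis
  proof (rule is_diagonal_absorb[OF E])
    show d_le_y: "d n \<le> y n" for n
      using d_le[of n] \<delta>_nonneg[of n] i by (auto simp: y_def suminf_\<delta> \<eta>_def field_simps)
    show "0 < y n" "0 \<le> d n" for n using d_le_y[of n] d_pos[of n] by linarith+
    \<comment> \<open>What is taken away at \<open>i\<close> is what the portions add elsewhere, so
      the total excess stays \<open>lam_neg\<close>.\<close>
    have "(\<lambda>n. lam n - d n + \<delta> n - (if n = i then suminf \<delta> else 0))
        sums (lam_neg + suminf \<delta> - suminf \<delta>)"
      using sums_single[of i "\<lambda>_. suminf \<delta>"] \<delta>_sums
      by (intro sums_diff sums_add sums) (simp_all add: suminf_\<delta>)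
    moreover have "(\<lambda>n. lam n - d n + \<delta> n - (if n = i then suminf \<delta> else 0)) = (\<lambda>n. y n - d n)"
      by (rule ext) (simp add: y_def \<delta>_i)
    ultimately show "(\<lambda>n. y n - d n) sums lam_neg" by simp
    \<comment> \<open>At \<open>n = m k\<close> the new entry is at most \<open>2 * q k\<close> and
      the new tail at most \<open>7/3 * q k\<close>, together less than \<open>5 * q k\<close>,
      while the new excess is at least \<open>q k\<close>.\<close>
    show "0 < (1/5 :: real)" by simp
    have good: "1/5 * (y n + (\<Sum>j. y (j + n) - d (j + n))) \<le> y n - d n" if n: "n = m k" for n k
    proof -
      have Qn: "i < n" "lam n \<le> q k" "(\<Sum>j. lam (j + n) - d (j + n)) \<le> q k"
        using Q[of k] n by (auto simp: Q_def)
      have tail: "(\<lambda>j. \<delta> (j + n)) sums (4/3 * q k)" using \<delta>_tail n by simp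
      have "(\<lambda>j. y (j + n) - d (j + n)) = (\<lambda>j. (lam (j + n) - d (j + n)) + \<delta> (j + n))"
        using Qn(1) by (auto simp: y_def)
      moreover have "summable (\<lambda>j. lam (j + n) - d (j + n))"
        using sums_summable[OF sums] by (rule summable_ignore_initial_segment)
      ultimately have "(\<Sum>j. y (j + n) - d (j + n)) \<le> q k + 4/3 * q k"
        using Qn(3) suminf_add[OF _ sums_summable[OF tail], of "\<lambda>j. lam (j + n) - d (j + n)"]
          sums_unique[OF tail] by simp
      moreover have "y n = lam n + q k" using Qn(1) \<delta>_m[of k] n by (simp add: y_def)
      ultimately show ?thesis using Qn(2) d_le[of n] q_pos[of k] by simp
    qed
    show "\<exists>\<^sub>\<infinity>n. 1/5 * (y n + (\<Sum>j. y (j + n) - d (j + n))) \<le> y n - d n"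
      unfolding INFM_nat_le using good strict_mono_imp_increasing[OF m] by blast
  qed
qed

end
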